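(* Let $P_{XY}$ and $Q_{XY}$ be probability distributions on $\mathbb{R}^d\times[K]$ and let $f:\mathbb{R}^d\to[K]$ be a classifier induced by a logit map $M_f:\mathbb{R}^d\to\mathbb{R}^K$, with margin $\gamma_f$ and score $s=-\gamma_f$. Assume: (A1) for all $x,x'\in\mathbb{R}^d$ and $y\in[K]$, $|\gamma_f(x,y)-\gamma_f(x',y)|\le L_\gamma\|x-x'\|_2$; (A2) $P_Y=Q_Y$, and for some $\rho>0$, $\sup_{y\in[K]}W_\infty(P_{X|y},Q_{X|y})<\rho$. Let $H:\mathbb{R}^d\to\mathbb{R}_{\ge0}$ be an uncertainty function, fix $u\in\mathbb{R}$ and $\alpha\in(0,1)$. Let $\mathcal{D}_Q^{\rm cal}=\{X_i\}_{i=1}^n$ with $X_i$ i.i.d. from $Q_X$, let $U_1,\dots,U_n$ be i.i.d. uniform on $[K]$, and let $(X,Y)\sim Q_{XY}$, with $X_{1:n}$, $U_{1:n}$ and $(X,Y)$ mutually independent; let $\mathbb{P}_{Q,U}$ denote their joint law. Let $q_{\tilde Q,\alpha}$ be the split-conformal threshold at level $\alpha$ computed from $\{s(X_i,f(X_i))\}_{i=1}^n$, and let $q_{\tilde Q^u,\alpha}$ be the split-conformal threshold at level $\alpha$ computed from $\{s(X_i,\tilde Y_u(X_i))\}_{i=1}^n$, where $$\tilde Y_u(X_i)=f(X_i)\,\mathbf{1}\{H(X_i)\le u\}+U_i\,\mathbf{1}\{H(X_i)>u\}.$$ Set $C^{1-\alpha}_{\tilde Q}(x):=\{y\in[K]:s(x,y)\le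 q_{\tilde Q,\alpha}\}$ and $C^{1-\alpha}_{\tilde Q^u}(x):=\{y\in[K]:s(x,y)\le q_{\tilde Q^u,\alpha}\}$. With $\nu_K$ the uniform distribution on $[K]$, define $$r_u(t):=(Q_X\otimes\nu_K)\{(x,v): H(x)>u,\ s(x,f(x))\le t<s(x,v)\},\qquad R_u:=\mathbb{E}_{\mathcal{D}_Q^{\rm cal},U_{1:n}}\big[r_u(q_{\tilde Q^u,\alpha})\big]\ge0.$$ Then: (i) $\mathbb{P}_{Q,U}\big(Y\in C^{1-\alpha}_{\tilde Q^u}(X)\big)\ge\mathbb{P}_{Q,U}\big(Y\in C^{1-\alpha}_{\tilde Q}(X)\big)$; (ii) $\mathbb{P}_{Q,U}\big(Y\in C^{1-\alpha}_{\tilde Q^u}(X)\big)\ge 1-\alpha-L_r(f,Q)+R_u$.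
   Context: $[K]=\{1,\dots,K\}$ with $K\ge2$. $P_X,P_Y$ denote marginals of $P_{XY}$ and $P_{X|y}$ the conditional law of $X$ given $Y=y$; similarly for $Q$. Classifier and margin: for a logit map $M_f:\mathbb{R}^d\to\mathbb{R}^K$, $f(x):=\arg\max_{k\in[K]}M_f(x)_k$, with ties broken by some fixed rule; $M_f$, $f$ and $H$ are measurable. The margin is $\gamma_f(x,y):=M_f(x)_y-\max_{k\ne y}M_f(x)_k$, and the nonconformity score is $s(x,y):=-\gamma_f(x,y)$. Ramp loss: with $r(t):=\min\{\max(1-t,0),1\}$, $L_r(f,Q):=\mathbb{E}_{(X,Y)\sim Q_{XY}}[r(\gamma_f(X,Y))]$. $W_\infty(\mu,\nu)=\inf_{\pi\in\Pi(\mu,\nu)}\operatorname{ess\,sup}_{(X,X')\sim\pi}\|X-X'\|_2$, where $\Pi(\mu,\nu)$ is the set of couplings of $\mu,\nu$. Split-conformal threshold: the threshold at level $\alpha$ computed from real scores $S_1,\dots,S_n$ is $\inf\{t\in\mathbb{R}:\frac1n\sum_{i=1}^n\mathbf{1}\{S_i\le t\}\ge \lceil(1-\alpha)(n+1)\rceil/n\}$, with $\inf\emptyset=+\infty$ (so it is $+\infty$ when $\lceil(1-\alpha)(n+1)\rceil>n$); in that case $r_u(+\infty)=0$. *)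

theory Defs
  imports "HOL-Probability.Probability"
begin

text \<open>
  The feature space is \<^typ>\<open>real^'d\<close> and the label set \<open>[K]\<close> is a finite type \<open>'k\<close> with
  \<open>K = CARD('k)\<close>, carrying the discrete sigma-algebra. A joint law of a feature and a label
  is a probability measure on the following measurable space.
\<close>

definition XY_space :: "((real^'d) \<times> 'k::finite) measure" where
  "XY_space = borel \<Otimes>\<^sub>M count_space UNIV"

definition law_X :: "((real^'d) \<times> 'k::finite) measure \<Rightarrow> (real^'d) measure" where
  "law_X P = distr P borel fst"

definition law_Y :: "((real^'d) \<times> 'k::finite) measure \<Rightarrow> 'k measure" where
  "law_Y P = distr P (count_space UNIV) snd"

text \<open>
  Law of the feature given that the label is \<open>y\<close>. It is meaningful only if \<open>y\<close> has positive
  probability; otherwise the formula below yields the zero measure.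
\<close>

definition cond_law :: "((real^'d) \<times> 'k::finite) measure \<Rightarrow> 'k \<Rightarrow> (real^'d) measure" where
  "cond_law P y = distr (uniform_measure P {z \<in> space P. snd z = y}) borel fst"

definition couplings :: "(real^'d) measure \<Rightarrow> (real^'d) measure \<Rightarrow> ((real^'d) \<times> (real^'d)) measure set" where
  "couplings \<mu> \<nu> = {\<pi>. prob_space \<pi> \<and> sets \<pi> = sets (borel \<Otimes>\<^sub>M borel) \<and>
     distr \<pi> borel fst = \<mu> \<and> distr \<pi> borel snd = \<nu>}"

definition W_inf :: "(real^'d) measure \<Rightarrow> (real^'d) measure \<Rightarrow> ereal" where
  "W_inf \<mu> \<nu> = (INF \<pi>\<in>couplings \<mu> \<nu>. esssup \<pi> (\<lambda>(x, x'). ereal (norm (x - x'))))"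

definition classifier_of :: "(real^'d \<Rightarrow> real^'k::finite) \<Rightarrow> (real^'d \<Rightarrow> 'k) \<Rightarrow> bool" where
  "classifier_of M f \<longleftrightarrow> (\<forall>x. is_arg_max (\<lambda>k. M x $ k) (\<lambda>_. True) (f x))"

definition margin :: "(real^'d \<Rightarrow> real^'k::finite) \<Rightarrow> real^'d \<Rightarrow> 'k \<Rightarrow> real" where
  "margin M x y = M x $ y - (MAX k\<in>UNIV - {y}. M x $ k)"

definition score :: "(real^'d \<Rightarrow> real^'k::finite) \<Rightarrow> real^'d \<Rightarrow> 'k \<Rightarrow> real" where
  "score M x y = - margin M x y"

definition ramp :: "real \<Rightarrow> real" where
  "ramp t = min (max (1 - t) 0) 1"

definition ramp_loss :: "(real^'d \<Rightarrow> real^'k::finite) \<Rightarrow> ((real^'d) \<times> 'k) measure \<Rightarrow> real" where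
  "ramp_loss M Q = (LINT (x, y)|Q. ramp (margin M x y))"

definition conformal_threshold :: "real \<Rightarrow> nat \<Rightarrow> (nat \<Rightarrow> real) \<Rightarrow> ereal" where
  "conformal_threshold \<alpha> n S =
     Inf (ereal ` {t. (1 / real n) * (\<Sum>i=1..n. of_bool (S i \<le> t))
                        \<ge> of_int \<lceil>(1 - \<alpha>) * (real n + 1)\<rceil> / real n})"

definition uncertain_label ::
    "(real^'d \<Rightarrow> 'k) \<Rightarrow> (real^'d \<Rightarrow> real) \<Rightarrow> real \<Rightarrow> real^'d \<Rightarrow> 'k \<Rightarrow> 'k" where
  "uncertain_label f H u x v = (if H x \<le> u then f x else v)"

definition threshold_pseudo ::
    "(real^'d \<Rightarrow> real^'k::finite) \<Rightarrow> (real^'d \<Rightarrow> 'k) \<Rightarrow> real \<Rightarrow> nat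
      \<Rightarrow> (nat \<Rightarrow> real^'d) \<Rightarrow> ereal" where
  "threshold_pseudo M f \<alpha> n xs = conformal_threshold \<alpha> n (\<lambda>i. score M (xs i) (f (xs i)))"

definition threshold_uncertain ::
    "(real^'d \<Rightarrow> real^'k::finite) \<Rightarrow> (real^'d \<Rightarrow> 'k) \<Rightarrow> (real^'d \<Rightarrow> real) \<Rightarrow> real \<Rightarrow> real \<Rightarrow> nat
      \<Rightarrow> (nat \<Rightarrow> real^'d) \<Rightarrow> (nat \<Rightarrow> 'k) \<Rightarrow> ereal" where
  "threshold_uncertain M f H u \<alpha> n xs us =
     conformal_threshold \<alpha> n (\<lambda>i. score M (xs i) (uncertain_label f H u (xs i) (us i)))"

definition prediction_set :: "(real^'d \<Rightarrow> real^'k::finite) \<Rightarrow> ereal \<Rightarrow> real^'d \<Rightarrow> 'k set" where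
  "prediction_set M q x = {y. ereal (score M x y) \<le> q}"

definition calibration_X :: "nat \<Rightarrow> ((real^'d) \<times> 'k::finite) measure \<Rightarrow> (nat \<Rightarrow> real^'d) measure" where
  "calibration_X n Q = (\<Pi>\<^sub>M i\<in>{1..n}. law_X Q)"

definition calibration_U :: "nat \<Rightarrow> (nat \<Rightarrow> 'k::finite) measure" where
  "calibration_U n = (\<Pi>\<^sub>M i\<in>{1..n}. uniform_count_measure UNIV)"

text \<open>Joint law of the independent triple \<open>X\<^sub>1, \<dots>, X\<^sub>n\<close>; \<open>U\<^sub>1, \<dots>, U\<^sub>n\<close>; \<open>(X, Y)\<close>.\<close>

definition joint_law ::
    "nat \<Rightarrow> ((real^'d) \<times> 'k::finite) measure
      \<Rightarrow> ((nat \<Rightarrow> real^'d) \<times> (nat \<Rightarrow> 'k) \<times> (real^'d) \<times> 'k) measure" where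
  "joint_law n Q = calibration_X n Q \<Otimes>\<^sub>M (calibration_U n \<Otimes>\<^sub>M Q)"

text \<open>
  The threshold argument \<open>t\<close> is an extended real; at \<open>t = \<infinity>\<close> the strict inequality fails,
  so the value there is 0.
\<close>

definition r_unc ::
    "(real^'d \<Rightarrow> real^'k::finite) \<Rightarrow> (real^'d \<Rightarrow> 'k) \<Rightarrow> (real^'d \<Rightarrow> real) \<Rightarrow> real
      \<Rightarrow> ((real^'d) \<times> 'k) measure \<Rightarrow> ereal \<Rightarrow> real" where
  "r_unc M f H u Q t =
     measure (law_X Q \<Otimes>\<^sub>M uniform_count_measure UNIV)
       {(x, v). H x > u \<and> ereal (score M x (f x)) \<le> t \<and> t < ereal (score M x v)}"

definition R_unc ::
    "(real^'d \<Rightarrow> real^'k::finite) \<Rightarrow> (real^'d \<Rightarrow> 'k) \<Rightarrow> (real^'d \<Rightarrow> real) \<Rightarrow> real \<Rightarrow> real \<Rightarrow> nat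
      \<Rightarrow> ((real^'d) \<times> 'k) measure \<Rightarrow> real" where
  "R_unc M f H u \<alpha> n Q =
     (LINT (xs, us)|(calibration_X n Q \<Otimes>\<^sub>M calibration_U n).
        r_unc M f H u Q (threshold_uncertain M f H u \<alpha> n xs us))"

lemma R_unc_nonneg: "R_unc M f H u \<alpha> n Q \<ge> 0"
  unfolding R_unc_def r_unc_def by (rule integral_nonneg_AE) (simp add: case_prod_beta)

end

theory Submission
  imports Defs
begin

text \<open>
  The classifier's label minimises the score, so replacing pseudo-labels by random labels can only
  increase the calibration scores and hence the threshold; this gives (i). For (ii), the calibration
  pairs \<open>(X\<^sub>i, U\<^sub>i)\<close> are i.i.d., so split-conformal coverage of the randomised label is at least
  \<open>1 - \<alpha>\<close>. At a fixed threshold \<open>t\<close>, the randomised label is covered exactly when the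
  pseudo-label is, up to the event of probability \<open>r\<^sub>u(t)\<close>; the pseudo-label in turn is covered with
  at most \<open>L\<^sub>r\<close> more probability than the true label. Integrating over the calibration data yields
  the bound.
\<close>

section \<open>Ranks and the split-conformal threshold\<close>

text \<open>Among the indices with at least \<open>k\<close> strictly smaller values, take one
  minimising \<open>S\<close>. Every index strictly below it escapes that set, which already gives
  \<open>k\<close> good indices. Only strict comparisons occur, so ties are harmless.\<close>

lemma card_few_smaller_ge:
  fixes S :: "'a \<Rightarrow> 'b::linorder"
  assumes J: "finite J" and k: "k \<le> card J"
  shows "k \<le> card {j\<in>J. card {i\<in>J. S i < S j} < k}"
proof (cases "{j\<in>J. k \<le> card {i\<in>J. S i < S j}} = {}")
  case True
  then have "{j\<in>J. card {i\<in>J. S i < S j} < k} = J" by force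
  then show ?thesis using k by simp
next
  case False
  let ?B = "{j\<in>J. k \<le> card {i\<in>J. S i < S j}}"
  have fin: "finite ?B" using J by simp
  from ex_is_arg_min_if_finite[OF fin False, of S] obtain j
    where j: "j \<in> ?B" and min: "\<And>i. i \<in> ?B \<Longrightarrow> \<not> S i < S j"
    unfolding is_arg_min_def by blast
  have "{i\<in>J. S i < S j} \<subseteq> {j\<in>J. card {i\<in>J. S i < S j} < k}"
    using min by force
  with J have "card {i\<in>J. S i < S j} \<le> card {j\<in>J. card {i\<in>J. S i < S j} < k}"
    by (intro card_mono) auto
  with j show ?thesis by auto
qed

text \<open>Clears the common factor \<open>1 / n\<close>, which needs \<open>n\<close> positive.
  The comparison stays in \<open>int\<close> because \<open>\<alpha>\<close> is unrestricted here
  and the ceiling may be negative.\<close>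

lemma conformal_threshold_eq:
  assumes "n \<ge> 1"
  shows "conformal_threshold \<alpha> n S =
    Inf (ereal ` {t. \<lceil>(1 - \<alpha>) * (real n + 1)\<rceil> \<le> int (card {i\<in>{1..n}. S i \<le> t})})"
proof -
  have "(\<Sum>i=1..n. of_bool (S i \<le> t)) = real (card {i\<in>{1..n}. S i \<le> t})" for t
    by (simp add: of_bool_def sum.If_cases Int_def)
  moreover have "real_of_int c / real n \<le> 1 / real n * real m \<longleftrightarrow> c \<le> int m" for c m
    using assms by (simp add: divide_le_cancel) linarith
  ultimately show ?thesis
    unfolding conformal_threshold_def by simp
qed

text \<open>An admissible \<open>t\<close> below \<open>s\<close> would only count scores strictly
  below \<open>s\<close>, and these are too few. This direction turns a rank bound into coverage
  without showing that the infimum is attained.\<close>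

lemma le_conformal_threshold:
  assumes n: "n \<ge> 1"
    and few: "int (card {i\<in>{1..n}. S i < s}) < \<lceil>(1 - \<alpha>) * (real n + 1)\<rceil>"
  shows "ereal s \<le> conformal_threshold \<alpha> n S"
  unfolding conformal_threshold_eq[OF n]
proof (rule Inf_greatest, clarify)
  fix t assume t: "\<lceil>(1 - \<alpha>) * (real n + 1)\<rceil> \<le> int (card {i\<in>{1..n}. S i \<le> t})"
  show "ereal s \<le> ereal t"
  proof (rule ccontr)
    assume "\<not> ereal s \<le> ereal t"
    then have "card {i\<in>{1..n}. S i \<le> t} \<le> card {i\<in>{1..n}. S i < s}"
      by (intro card_mono) auto
    with t few show False by linarith
  qed
qed

text \<open>Raising the scores lowers every count, so fewer \<open>t\<close> are admissible and the
  infimum grows. An empty admissible set gives infinity and is no special case.\<close>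

lemma conformal_threshold_mono:
  assumes n: "n \<ge> 1" and le: "\<And>i. i \<in> {1..n} \<Longrightarrow> S i \<le> S' i"
  shows "conformal_threshold \<alpha> n S \<le> conformal_threshold \<alpha> n S'"
  unfolding conformal_threshold_eq[OF n]
proof (rule Inf_superset_mono, rule image_mono, clarify)
  fix t assume t: "\<lceil>(1 - \<alpha>) * (real n + 1)\<rceil> \<le> int (card {i\<in>{1..n}. S' i \<le> t})"
  have "card {i\<in>{1..n}. S' i \<le> t} \<le> card {i\<in>{1..n}. S i \<le> t}"
    using le by (intro card_mono) (auto intro: order_trans)
  with t show "\<lceil>(1 - \<alpha>) * (real n + 1)\<rceil> \<le> int (card {i\<in>{1..n}. S i \<le> t})" by linarith
qed

text \<open>Admissibility is upward closed in \<open>t\<close>, so an admissible real below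
  \<open>a\<close> can be moved up to a rational still below \<open>a\<close>. Sublevel sets thus
  become countable unions, which yields measurability of the threshold.\<close>

lemma conformal_threshold_less_iff:
  assumes n: "n \<ge> 1"
  shows "conformal_threshold \<alpha> n S < a \<longleftrightarrow>
    (\<exists>r::rat. ereal (of_rat r) < a \<and>
      \<lceil>(1 - \<alpha>) * (real n + 1)\<rceil> \<le> int (card {i\<in>{1..n}. S i \<le> of_rat r}))"
proof
  assume "conformal_threshold \<alpha> n S < a"
  then obtain t where t: "ereal t < a"
    and c: "\<lceil>(1 - \<alpha>) * (real n + 1)\<rceil> \<le> int (card {i\<in>{1..n}. S i \<le> t})"
    unfolding conformal_threshold_eq[OF n] Inf_less_iff by auto
  obtain b where b: "t < b" "ereal b < a"
    using ereal_dense2[OF t] by auto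
  obtain r where r: "t < of_rat r" "of_rat r < b"
    using of_rat_dense[OF b(1)] by auto
  have "card {i\<in>{1..n}. S i \<le> t} \<le> card {i\<in>{1..n}. S i \<le> of_rat r}"
    using r by (intro card_mono) auto
  with c have "\<lceil>(1 - \<alpha>) * (real n + 1)\<rceil> \<le> int (card {i\<in>{1..n}. S i \<le> of_rat r})" by linarith
  moreover have "ereal (of_rat r) < a" using r b by (meson ereal_less(2) less_ereal.simps(1) order_less_trans)
  ultimately show "\<exists>r::rat. ereal (of_rat r) < a \<and>
      \<lceil>(1 - \<alpha>) * (real n + 1)\<rceil> \<le> int (card {i\<in>{1..n}. S i \<le> of_rat r})" by blast
next
  assume "\<exists>r::rat. ereal (of_rat r) < a \<and>
      \<lceil>(1 - \<alpha>) * (real n + 1)\<rceil> \<le> int (card {i\<in>{1..n}. S i \<le> of_rat r})"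
  then show "conformal_threshold \<alpha> n S < a"
    unfolding conformal_threshold_eq[OF n] Inf_less_iff by auto
qed

lemma measurable_card_Collect:
  assumes "finite I" and [measurable]: "\<And>i. i \<in> I \<Longrightarrow> Measurable.pred N (P i)"
  shows "(\<lambda>w. card {i\<in>I. P i w}) \<in> measurable N (count_space UNIV)"
proof -
  have "card {i\<in>I. P i w} = (\<Sum>i\<in>I. of_bool (P i w))" for w
    using \<open>finite I\<close> by (simp add: of_bool_def sum.If_cases Int_def)
  moreover have "(\<lambda>w. \<Sum>i\<in>I. of_bool (P i w) :: nat) \<in> measurable N (count_space UNIV)"
    unfolding of_bool_def by measurable
  ultimately show ?thesis by simp
qed

lemma borel_measurable_conformal_threshold:
  assumes n: "n \<ge> 1" and S: "\<And>i. i \<in> {1..n} \<Longrightarrow> (\<lambda>w. S w i) \<in> borel_measurable N"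
  shows "(\<lambda>w. conformal_threshold \<alpha> n (S w)) \<in> borel_measurable N"
proof (rule borel_measurableI_less)
  fix a :: ereal
  note S[measurable]
  have card: "(\<lambda>w. card {i\<in>{1..n}. S w i \<le> of_rat r}) \<in> measurable N (count_space UNIV)" for r
    by (rule measurable_card_Collect) measurable
  have "{w \<in> space N. conformal_threshold \<alpha> n (S w) < a} =
    (\<Union>r\<in>{r. ereal (of_rat r) < a}. (\<lambda>w. card {i\<in>{1..n}. S w i \<le> of_rat r}) -`
      {m. \<lceil>(1 - \<alpha>) * (real n + 1)\<rceil> \<le> int m} \<inter> space N)"
    unfolding conformal_threshold_less_iff[OF n] by blast
  also have "\<dots> \<in> sets N"
    by (intro sets.countable_UN'' measurable_sets[OF card]) simp_all
  finally show "{w \<in> space N. conformal_threshold \<alpha> n (S w) < a} \<in> sets N" .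
qed

section \<open>Slices of product measures and exchangeable coverage\<close>

lemma
  assumes A: "prob_space A" and B: "prob_space B" and S: "S \<in> sets (A \<Otimes>\<^sub>M B)"
  shows measure_pair_eq_integral: "measure (A \<Otimes>\<^sub>M B) S = (\<integral>a. measure B (Pair a -` S) \<partial>A)"
    and integrable_measure_Pair: "integrable A (\<lambda>a. measure B (Pair a -` S))"
proof -
  interpret A: prob_space A by fact
  interpret B: prob_space B by fact
  have m: "(\<lambda>a. measure B (Pair a -` S)) \<in> borel_measurable A"
    unfolding measure_def using B.measurable_emeasure_Pair[OF S] by measurable
  show int: "integrable A (\<lambda>a. measure B (Pair a -` S))"
    using m by (intro A.integrable_const_bound[where B=1]) auto
  have "emeasure (A \<Otimes>\<^sub>M B) S = (\<integral>\<^sup>+a. measure B (Pair a -` S) \<partial>A)"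
    by (simp add: B.emeasure_pair_measure_alt[OF S] B.emeasure_eq_measure)
  also have "\<dots> = (\<integral>a. measure B (Pair a -` S) \<partial>A)"
    using int by (intro nn_integral_eq_integral) auto
  finally show "measure (A \<Otimes>\<^sub>M B) S = (\<integral>a. measure B (Pair a -` S) \<partial>A)"
    by (simp add: measure_def integral_nonneg_AE)
qed

text \<open>Exchangeability: each of the \<open>n + 1\<close> i.i.d. scores, the test score being number \<open>0\<close>, is
  equally likely to have fewer than \<open>k\<close> scores strictly below it, and at least \<open>k\<close> of them do.\<close>

lemma conformal_coverage:
  assumes mu: "prob_space \<mu>" "sets \<mu> = sets borel" and n: "n \<ge> 1" and \<alpha>: "0 < \<alpha>"
  shows "1 - \<alpha> \<le> (\<integral>S. measure \<mu> {s. ereal s \<le> conformal_threshold \<alpha> n S} \<partial>(\<Pi>\<^sub>M i\<in>{1..n}. \<mu>))"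
proof -
  define J where "J = insert 0 {1..n}"
  define k where "k = nat \<lceil>(1 - \<alpha>) * (real n + 1)\<rceil>"
  define P where "P = (\<Pi>\<^sub>M i\<in>J. \<mu>)"
  define N where "N = (\<Pi>\<^sub>M i\<in>{1..n}. \<mu>)"
  define E where "E = (\<lambda>j. {S \<in> space P. card {i\<in>J. S i < S j} < k})"
  note mu(2)[measurable_cong]
  interpret mu: prob_space \<mu> by fact
  interpret P: prob_space P unfolding P_def by (rule prob_space_PiM) (rule mu(1))
  interpret N: prob_space N unfolding N_def by (rule prob_space_PiM) (rule mu(1))
  have spmu: "space \<mu> = UNIV" using sets_eq_imp_space_eq[OF mu(2)] by simp
  have J: "finite J" "card J = n + 1" by (auto simp: J_def)
  have comp[measurable]: "(\<lambda>S. S i) \<in> borel_measurable P" if "i \<in> J" for i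
    using measurable_component_singleton[OF that, of "\<lambda>_. \<mu>"]
    by (simp add: P_def measurable_cong_sets[OF refl mu(2)])
  have cardm: "(\<lambda>S. card {i\<in>J. S i < S j}) \<in> measurable P (count_space UNIV)" if "j \<in> J" for j
    using J(1) comp that by (intro measurable_card_Collect) auto
  have E[measurable]: "E j \<in> sets P" if "j \<in> J" for j
    using cardm[OF that] unfolding E_def by measurable
  \<comment> \<open>Swapping coordinates \<open>0\<close> and \<open>j\<close> preserves the product
    law and pulls \<open>E j\<close> back to \<open>E 0\<close>.\<close>
  have sym: "P.prob (E j) = P.prob (E 0)" if j: "j \<in> J" for j
  proof -
    define \<tau> where "\<tau> = Transposition.transpose 0 j"
    have \<tau>: "bij_betw \<tau> J J" unfolding \<tau>_def
      using j by (intro permutes_imp_bij permutes_swap_id) (auto simp: J_def)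
    define T where "T = (\<lambda>S::nat \<Rightarrow> real. \<lambda>i\<in>J. S (\<tau> i))"
    have dT: "distr P P T = P"
      unfolding P_def T_def
      using distr_PiM_reindex[of J "\<lambda>_. \<mu>" \<tau> J] mu(1) \<tau> by (auto simp: bij_betw_def)
    have T[measurable]: "T \<in> measurable P P"
      unfolding T_def P_def using \<tau>
      by (intro measurable_restrict measurable_component_singleton) (auto simp: bij_betw_def)
    have \<tau>j: "\<tau> j = 0" "0 \<in> J" by (auto simp: \<tau>_def J_def)
    have "card {i\<in>J. T S i < T S j} = card {i\<in>J. S i < S 0}" for S
    proof -
      have "bij_betw \<tau> {i\<in>J. S (\<tau> i) < S 0} {i\<in>J. S i < S 0}"
        using \<tau> by (rule bij_betw_Collect) auto
      then have "card {i\<in>J. S (\<tau> i) < S 0} = card {i\<in>J. S i < S 0}" by (rule bij_betw_same_card)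
      moreover have "{i\<in>J. T S i < T S j} = {i\<in>J. S (\<tau> i) < S 0}"
        using \<tau>j j by (auto simp: T_def)
      ultimately show ?thesis by simp
    qed
    then have "T -` E j \<inter> space P = E 0"
      using measurable_space[OF T] by (auto simp: E_def)
    then have "measure (distr P P T) (E j) = P.prob (E 0)"
      using E[OF j] by (simp add: measure_distr)
    then show ?thesis by (simp add: dT)
  qed
  define G where "G = {z \<in> space (N \<Otimes>\<^sub>M \<mu>). ereal (snd z) \<le> conformal_threshold \<alpha> n (fst z)}"
  have qm[measurable]: "conformal_threshold \<alpha> n \<in> borel_measurable N"
    using measurable_component_singleton[of _ "{1..n}" "\<lambda>_. \<mu>"]
    by (intro borel_measurable_conformal_threshold[OF n])
      (simp add: N_def measurable_cong_sets[OF refl mu(2)])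
  have G: "G \<in> sets (N \<Otimes>\<^sub>M \<mu>)" unfolding G_def by measurable
  interpret N\<mu>: pair_prob_space N \<mu> by standard
  have k_le: "k \<le> card J"
  proof -
    have "(1 - \<alpha>) * (real n + 1) \<le> 1 * (real n + 1)" using \<alpha> by (intro mult_right_mono) auto
    then have "\<lceil>(1 - \<alpha>) * (real n + 1)\<rceil> \<le> int n + 1" by (simp add: ceiling_le_iff)
    then show ?thesis unfolding k_def J by linarith
  qed
  \<comment> \<open>Double counting: the number of events \<open>E j\<close> that occur is at least
    \<open>k\<close> pointwise, so the expected number is too, and by symmetry it equals
    \<open>(n + 1)\<close> times the probability of \<open>E 0\<close>.\<close>
  have "real k = (\<integral>S. real k \<partial>P)" using P.prob_space by simp
  also have "\<dots> \<le> (\<integral>S. (\<Sum>j\<in>J. indicator (E j) S) \<partial>P)"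
  proof (rule integral_mono)
    fix S assume "S \<in> space P"
    then have "(\<Sum>j\<in>J. indicator (E j) S :: real) = real (card {j\<in>J. card {i\<in>J. S i < S j} < k})"
      using J(1) by (simp add: E_def indicator_def sum.If_cases Int_def)
    then show "real k \<le> (\<Sum>j\<in>J. indicator (E j) S)"
      using card_few_smaller_ge[OF J(1) k_le, of S] by simp
  qed (auto intro!: integrable_real_indicator simp: less_top[symmetric])
  also have "\<dots> = (\<Sum>j\<in>J. P.prob (E j))"
    by (subst Bochner_Integration.integral_sum) (auto simp: less_top[symmetric] intro!: sum.cong)
  also have "\<dots> = (real n + 1) * P.prob (E 0)"
    using sym J by simp
  finally have E0: "real k \<le> (real n + 1) * P.prob (E 0)" .
  \<comment> \<open>Truncation by \<open>nat\<close> can only raise a negative ceiling, so the bound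
    holds whatever its sign.\<close>
  have "(1 - \<alpha>) * (real n + 1) \<le> real k" unfolding k_def by linarith
  with E0 have "(1 - \<alpha>) * (real n + 1) \<le> P.prob (E 0) * (real n + 1)"
    by (metis order_trans mult.commute)
  then have "1 - \<alpha> \<le> P.prob (E 0)"
    by (rule mult_le_cancel_right_pos[THEN iffD1, rotated]) simp
  also have "\<dots> \<le> measure (N \<Otimes>\<^sub>M \<mu>) G"
  proof -
    interpret product_sigma_finite "\<lambda>_::nat. \<mu>" by standard
    have ind: "(indicator (E 0) :: _ \<Rightarrow> ennreal) \<in> borel_measurable P"
      using E[of 0] by (simp add: J_def)
    \<comment> \<open>Coordinate \<open>0\<close> is integrated out separately: it becomes the test
      score, and the other \<open>n\<close> coordinates form the calibration sample.\<close>
    have "emeasure P (E 0) = (\<integral>\<^sup>+S. indicator (E 0) S \<partial>P)" by (simp add: J_def)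
    also have "\<dots> = (\<integral>\<^sup>+S. (\<integral>\<^sup>+s. indicator (E 0) (S(0 := s)) \<partial>\<mu>) \<partial>N)"
      unfolding P_def J_def N_def
      by (rule product_nn_integral_insert[OF _ _ ind[unfolded P_def J_def]]) auto
    also have "\<dots> \<le> (\<integral>\<^sup>+S. emeasure \<mu> (Pair S -` G) \<partial>N)"
    proof (rule nn_integral_mono)
      fix S assume S: "S \<in> space N"
      have "s \<in> Pair S -` G" if s: "S(0 := s) \<in> E 0" for s
      proof -
        have "card {i\<in>J. (S(0 := s)) i < s} < k" using s by (simp add: E_def)
        \<comment> \<open>The test score is never strictly below itself, so its rank among all
          \<open>n + 1\<close> scores only counts calibration scores.\<close>
        moreover have "{i\<in>J. (S(0 := s)) i < s} = {i\<in>{1..n}. S i < s}" by (auto simp: J_def)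
        ultimately have "card {i\<in>{1..n}. S i < s} < k" by simp
        then have "int (card {i\<in>{1..n}. S i < s}) < \<lceil>(1 - \<alpha>) * (real n + 1)\<rceil>"
          unfolding k_def by (simp add: zless_nat_eq_int_zless)
        from le_conformal_threshold[OF n this] S show ?thesis by (simp add: G_def space_pair_measure spmu)
      qed
      then have "indicator (E 0) (S(0 := s)) \<le> (indicator (Pair S -` G) s :: ennreal)" for s
        by (auto simp: indicator_def)
      then have "(\<integral>\<^sup>+s. indicator (E 0) (S(0 := s)) \<partial>\<mu>) \<le> (\<integral>\<^sup>+s. indicator (Pair S -` G) s \<partial>\<mu>)"
        by (intro nn_integral_mono) auto
      also have "\<dots> = emeasure \<mu> (Pair S -` G)"
        using sets_Pair1[OF G] by simp
      finally show "(\<integral>\<^sup>+s. indicator (E 0) (S(0 := s)) \<partial>\<mu>) \<le> emeasure \<mu> (Pair S -` G)" .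
    qed
    also have "\<dots> = emeasure (N \<Otimes>\<^sub>M \<mu>) G"
      using mu.emeasure_pair_measure_alt[OF G] by simp
    finally show ?thesis
      by (simp add: P.emeasure_eq_measure N\<mu>.emeasure_eq_measure)
  qed
  also have "\<dots> = (\<integral>S. measure \<mu> (Pair S -` G) \<partial>N)"
    by (rule measure_pair_eq_integral) (fact N.prob_space_axioms mu.prob_space_axioms G)+
  also have "\<dots> = (\<integral>S. measure \<mu> {s. ereal s \<le> conformal_threshold \<alpha> n S} \<partial>N)"
    by (intro Bochner_Integration.integral_cong) (auto simp: G_def vimage_def space_pair_measure spmu)
  finally show ?thesis unfolding N_def .
qed


section \<open>Laws of i.i.d. families and triple products\<close>

text \<open>Turns separately drawn features and labels into i.i.d. scores. It suffices to compare
  measures of boxes: fixing the first family, the probability over the second factorises, and the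
  integral of that product over the first factorises again.\<close>

lemma distr_PiM_pair:
  fixes I :: "'i set"
  assumes N1: "prob_space N1" and N2: "prob_space N2" and I: "finite I"
    and g[measurable]: "g \<in> measurable (N1 \<Otimes>\<^sub>M N2) K"
  defines "D \<equiv> distr (N1 \<Otimes>\<^sub>M N2) K g"
  shows "distr ((\<Pi>\<^sub>M i\<in>I. N1) \<Otimes>\<^sub>M (\<Pi>\<^sub>M i\<in>I. N2)) (\<Pi>\<^sub>M i\<in>I. D)
    (\<lambda>w. \<lambda>i\<in>I. g (fst w i, snd w i)) = (\<Pi>\<^sub>M i\<in>I. D)"
proof -
  define W where "W = (\<Pi>\<^sub>M i\<in>I. N1) \<Otimes>\<^sub>M (\<Pi>\<^sub>M i\<in>I. N2)"
  interpret N1: prob_space N1 by fact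
  interpret N2: prob_space N2 by fact
  interpret P12: pair_prob_space N1 N2 by standard
  interpret D: prob_space D unfolding D_def by (rule P12.prob_space_distr) fact
  interpret p1: product_sigma_finite "\<lambda>_::'i. N1" by standard
  interpret p2: product_sigma_finite "\<lambda>_::'i. N2" by standard
  interpret pD: product_sigma_finite "\<lambda>_::'i. D" by standard
  interpret P2: prob_space "\<Pi>\<^sub>M i\<in>I. N2" by (rule prob_space_PiM) (rule N2)
  have T: "(\<lambda>w. \<lambda>i\<in>I. g (fst w i, snd w i)) \<in> measurable W (\<Pi>\<^sub>M i\<in>I. D)"
    unfolding W_def D_def by measurable
  show ?thesis
    unfolding W_def[symmetric]
  proof (rule pD.PiM_eqI[OF I])
    fix A assume "\<And>i. i \<in> I \<Longrightarrow> A i \<in> sets D"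
    then have A[measurable]: "\<And>i. i \<in> I \<Longrightarrow> A i \<in> sets K" by (simp add: D_def)
    have PA: "Pi\<^sub>E I A \<in> sets (\<Pi>\<^sub>M i\<in>I. D)"
      using I A by (intro sets_PiM_I_finite) (auto simp: D_def)
    define B where "B = (\<lambda>i. g -` A i \<inter> space (N1 \<Otimes>\<^sub>M N2))"
    have B[measurable]: "B i \<in> sets (N1 \<Otimes>\<^sub>M N2)" if "i \<in> I" for i
      unfolding B_def using A[OF that] by measurable
    let ?S = "(\<lambda>w. \<lambda>i\<in>I. g (fst w i, snd w i)) -` Pi\<^sub>E I A \<inter> space W"
    have "emeasure (distr W (\<Pi>\<^sub>M i\<in>I. D) (\<lambda>w. \<lambda>i\<in>I. g (fst w i, snd w i))) (Pi\<^sub>E I A) = emeasure W ?S"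
      by (rule emeasure_distr[OF T PA])
    also have "\<dots> = (\<integral>\<^sup>+xs. emeasure (\<Pi>\<^sub>M i\<in>I. N2) (Pair xs -` ?S) \<partial>(\<Pi>\<^sub>M i\<in>I. N1))"
      using measurable_sets[OF T PA] unfolding W_def by (rule P2.emeasure_pair_measure_alt)
    also have "\<dots> = (\<integral>\<^sup>+xs. (\<Prod>i\<in>I. emeasure N2 (Pair (xs i) -` B i)) \<partial>(\<Pi>\<^sub>M i\<in>I. N1))"
    proof (rule nn_integral_cong)
      fix xs assume xs: "xs \<in> space (\<Pi>\<^sub>M i\<in>I. N1)"
      then have "Pair xs -` ?S = Pi\<^sub>E I (\<lambda>i. Pair (xs i) -` B i)"
        by (auto simp: W_def B_def space_pair_measure space_PiM restrict_PiE_iff PiE_iff)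
      then show "emeasure (\<Pi>\<^sub>M i\<in>I. N2) (Pair xs -` ?S) = (\<Prod>i\<in>I. emeasure N2 (Pair (xs i) -` B i))"
        using I sets_Pair1[OF B] by (simp add: p2.emeasure_PiM)
    qed
    also have "\<dots> = (\<Prod>i\<in>I. \<integral>\<^sup>+x. emeasure N2 (Pair x -` B i) \<partial>N1)"
      using I N2.measurable_emeasure_Pair[OF B] by (rule p1.product_nn_integral_prod)
    also have "\<dots> = (\<Prod>i\<in>I. emeasure D (A i))"
    proof (intro prod.cong refl)
      fix i assume i: "i \<in> I"
      have "(\<integral>\<^sup>+x. emeasure N2 (Pair x -` B i) \<partial>N1) = emeasure (N1 \<Otimes>\<^sub>M N2) (B i)"
        using B[OF i] by (rule N2.emeasure_pair_measure_alt[symmetric])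
      also have "\<dots> = emeasure D (A i)"
        unfolding D_def B_def using g A[OF i] by (rule emeasure_distr[symmetric])
      finally show "(\<integral>\<^sup>+x. emeasure N2 (Pair x -` B i) \<partial>N1) = emeasure D (A i)" .
    qed
    finally show "emeasure (distr W (\<Pi>\<^sub>M i\<in>I. D) (\<lambda>w. \<lambda>i\<in>I. g (fst w i, snd w i))) (Pi\<^sub>E I A)
      = (\<Prod>i\<in>I. emeasure D (A i))" .
  qed simp
qed

text \<open>The joint law is nested as \<open>A\<close>, then \<open>B\<close> with
  \<open>C\<close>, whereas the argument fixes all calibration data and slices over the test pair.
  The proof reassociates the product and applies Fubini.\<close>

lemma measure_triple_eq_integral:
  assumes A: "prob_space A" and B: "prob_space B" and C: "prob_space C"
    and S[measurable]: "S \<in> sets (A \<Otimes>\<^sub>M (B \<Otimes>\<^sub>M C))"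
  shows "measure (A \<Otimes>\<^sub>M (B \<Otimes>\<^sub>M C)) S = (\<integral>w. measure C {c. (fst w, snd w, c) \<in> S} \<partial>(A \<Otimes>\<^sub>M B))"
proof -
  interpret A: prob_space A by fact
  interpret B: prob_space B by fact
  interpret C: prob_space C by fact
  interpret AB: pair_prob_space A B by standard
  interpret BC: pair_prob_space B C by standard
  let ?S = "(\<lambda>z. (fst (fst z), snd (fst z), snd z)) -` S \<inter> space ((A \<Otimes>\<^sub>M B) \<Otimes>\<^sub>M C)"
  have S': "?S \<in> sets ((A \<Otimes>\<^sub>M B) \<Otimes>\<^sub>M C)"
    by measurable
  have eq: "Pair w -` ?S = {c. (fst w, snd w, c) \<in> S}" if "w \<in> space (A \<Otimes>\<^sub>M B)" for w
    using that sets.sets_into_space[OF S] by (auto simp: space_pair_measure)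
  have "measure (A \<Otimes>\<^sub>M (B \<Otimes>\<^sub>M C)) S = (\<integral>a. measure (B \<Otimes>\<^sub>M C) (Pair a -` S) \<partial>A)"
    by (rule measure_pair_eq_integral) (fact A BC.prob_space_axioms S)+
  also have "\<dots> = (\<integral>a. (\<integral>b. measure C (Pair (a, b) -` ?S) \<partial>B) \<partial>A)"
  proof (intro Bochner_Integration.integral_cong refl)
    fix a assume a: "a \<in> space A"
    have "measure (B \<Otimes>\<^sub>M C) (Pair a -` S) = (\<integral>b. measure C (Pair b -` Pair a -` S) \<partial>B)"
      by (rule measure_pair_eq_integral) (fact B C sets_Pair1[OF S])+
    also have "\<dots> = (\<integral>b. measure C (Pair (a, b) -` ?S) \<partial>B)"
    proof (intro Bochner_Integration.integral_cong refl)
      fix b assume "b \<in> space B"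
      then have "Pair b -` Pair a -` S = Pair (a, b) -` ?S"
        using a eq[of "(a, b)"] by (auto simp: space_pair_measure)
      then show "measure C (Pair b -` Pair a -` S) = measure C (Pair (a, b) -` ?S)" by simp
    qed
    finally show "measure (B \<Otimes>\<^sub>M C) (Pair a -` S) = (\<integral>b. measure C (Pair (a, b) -` ?S) \<partial>B)" .
  qed
  also have "\<dots> = (\<integral>w. measure C (Pair w -` ?S) \<partial>(A \<Otimes>\<^sub>M B))"
    by (rule AB.integral_fst') (rule integrable_measure_Pair[OF AB.prob_space_axioms C S'])
  also have "\<dots> = (\<integral>w. measure C {c. (fst w, snd w, c) \<in> S} \<partial>(A \<Otimes>\<^sub>M B))"
    by (intro Bochner_Integration.integral_cong refl arg_cong[where f="measure C"] eq)
  finally show ?thesis .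
qed

section \<open>Margins, scores, ramp loss and coverage at a fixed threshold\<close>

lemma margin_nonpos:
  assumes "classifier_of M f" and "y \<noteq> f x"
  shows "margin M x y \<le> 0"
proof -
  have "M x $ y \<le> M x $ f x"
    using assms(1) by (auto simp: classifier_of_def is_arg_max_linorder)
  also have "\<dots> \<le> (MAX k\<in>UNIV - {y}. M x $ k)"
    using assms(2) by (intro Max_ge) auto
  finally show ?thesis by (simp add: margin_def)
qed

text \<open>Two labels make the set of competitors nonempty, so its \<open>Max\<close> is attained
  by an actual logit, which the arg max dominates.\<close>

lemma margin_classifier_nonneg:
  fixes M :: "real^'d \<Rightarrow> real^'k::finite"
  assumes "classifier_of M f" and "CARD('k) \<ge> 2"
  shows "0 \<le> margin M x (f x)"
proof -
  have "UNIV - {f x} \<noteq> {}"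
  proof
    assume "UNIV - {f x} = {}"
    then have "card (UNIV :: 'k set) \<le> card {f x}" by (intro card_mono) auto
    with assms(2) show False by simp
  qed
  then have "(MAX k\<in>UNIV - {f x}. M x $ k) \<le> M x $ f x"
    using assms(1) by (subst Max_le_iff) (auto simp: classifier_of_def is_arg_max_linorder)
  then show ?thesis by (simp add: margin_def)
qed

text \<open>Zero separates the scores: the predicted label has a nonpositive one, every other label
  a nonnegative one.\<close>

lemma score_classifier_le:
  fixes M :: "real^'d \<Rightarrow> real^'k::finite"
  assumes "classifier_of M f" and "CARD('k) \<ge> 2"
  shows "score M x (f x) \<le> score M x y"
  using margin_nonpos[OF assms(1), of y x] margin_classifier_nonneg[OF assms, of x]
  by (cases "y = f x") (auto simp: score_def)

lemma borel_measurable_margin: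
  assumes M[measurable]: "M \<in> borel_measurable borel"
  shows "(\<lambda>z. margin M (fst z) (snd z)) \<in> borel_measurable (borel \<Otimes>\<^sub>M count_space (UNIV :: 'k::finite set))"
proof -
  have "(\<lambda>x. M x $ y) \<in> borel_measurable borel" for y
    by (rule measurable_compose[OF M]) simp
  then have 1: "(\<lambda>x. margin M x y) \<in> borel_measurable borel" for y
    unfolding margin_def by (intro borel_measurable_diff borel_measurable_Max) auto
  show ?thesis
    by (rule measurable_compose_countable[OF measurable_compose[OF measurable_fst 1] measurable_snd])
qed

text \<open>The ramp is nonnegative and equals 1 at nonpositive margins, so it dominates the
  indicator of that event.\<close>

lemma ramp_loss_ge:
  fixes Q :: "((real^'d) \<times> 'k::finite) measure"
  assumes Q: "prob_space Q" "sets Q = sets XY_space" and M: "M \<in> borel_measurable borel"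
  shows "measure Q {z. margin M (fst z) (snd z) \<le> 0} \<le> ramp_loss M Q"
proof -
  interpret Q: prob_space Q by fact
  have [simp]: "space Q = UNIV"
    using sets_eq_imp_space_eq[OF Q(2)] by (simp add: XY_space_def space_pair_measure)
  have m[measurable]: "(\<lambda>z. margin M (fst z) (snd z)) \<in> borel_measurable Q"
    using borel_measurable_margin[OF M] Q(2) by (simp add: XY_space_def cong: measurable_cong_sets)
  have rm: "(\<lambda>z. ramp (margin M (fst z) (snd z))) \<in> borel_measurable Q"
    unfolding ramp_def by measurable
  have "{z \<in> space Q. margin M (fst z) (snd z) \<le> 0} \<in> sets Q" by measurable
  then have S: "{z. margin M (fst z) (snd z) \<le> 0} \<in> sets Q" by simp
  then have "measure Q {z. margin M (fst z) (snd z) \<le> 0} =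
      (\<integral>z. indicator {z. margin M (fst z) (snd z) \<le> 0} z \<partial>Q)" by simp
  also have "\<dots> \<le> (\<integral>z. ramp (margin M (fst z) (snd z)) \<partial>Q)"
  proof (rule integral_mono)
    show "integrable Q (indicator {z. margin M (fst z) (snd z) \<le> 0} :: _ \<Rightarrow> real)"
      using S by (intro integrable_real_indicator) (auto simp: less_top[symmetric])
    show "integrable Q (\<lambda>z. ramp (margin M (fst z) (snd z)))"
      using rm by (intro Q.integrable_const_bound[where B=1]) (auto simp: ramp_def)
  qed (auto simp: ramp_def indicator_def)
  finally show ?thesis by (simp add: ramp_loss_def case_prod_unfold)
qed

lemma borel_measurable_score:
  assumes "M \<in> borel_measurable borel"
  shows "(\<lambda>z. score M (fst z) (snd z)) \<in> borel_measurable (borel \<Otimes>\<^sub>M count_space (UNIV :: 'k::finite set))"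
  using borel_measurable_margin[OF assms] unfolding score_def by measurable

lemma borel_measurable_score_classifier:
  assumes M: "M \<in> borel_measurable borel" and f: "f \<in> measurable borel (count_space UNIV)"
  shows "(\<lambda>x. score M x (f x)) \<in> borel_measurable borel"
proof -
  have "(\<lambda>x. (x, f x)) \<in> measurable borel (borel \<Otimes>\<^sub>M count_space UNIV)"
    using f by (intro measurable_Pair) auto
  from measurable_compose[OF this borel_measurable_score[OF M]] show ?thesis by simp
qed

lemma borel_measurable_score_uncertain:
  fixes M :: "real^'d \<Rightarrow> real^'k::finite"
  assumes M: "M \<in> borel_measurable borel" and f: "f \<in> measurable borel (count_space UNIV)"
    and H: "H \<in> borel_measurable borel"
  shows "(\<lambda>z. score M (fst z) (uncertain_label f H u (fst z) (snd z)))
    \<in> borel_measurable (borel \<Otimes>\<^sub>M count_space UNIV)"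
proof -
  note borel_measurable_score[OF M, measurable] H[measurable]
  have [measurable]: "(\<lambda>z. score M (fst z) (f (fst z))) \<in>
      borel_measurable (borel \<Otimes>\<^sub>M count_space (UNIV :: 'k set))"
    by (rule measurable_compose[OF measurable_fst borel_measurable_score_classifier[OF M f]])
  have "(\<lambda>z. if H (fst z) \<le> u then score M (fst z) (f (fst z)) else score M (fst z) (snd z))
    \<in> borel_measurable (borel \<Otimes>\<^sub>M count_space (UNIV :: 'k set))"
    by measurable
  then show ?thesis
    by (rule measurable_cong[THEN iffD1, rotated]) (simp add: uncertain_label_def)
qed

text \<open>A pseudo-label that is covered while the true label is not forces a misclassification, hence a
  nonpositive margin and ramp loss one.\<close>

lemma coverage_at_threshold_ge:
  fixes Q :: "((real^'d) \<times> 'k::finite) measure" and M :: "real^'d \<Rightarrow> real^'k"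
  assumes K: "CARD('k) \<ge> 2"
    and Q: "prob_space Q" "sets Q = sets XY_space" and M: "M \<in> borel_measurable borel"
    and f: "f \<in> measurable borel (count_space UNIV)" "classifier_of M f"
    and H: "H \<in> borel_measurable borel"
  defines "N \<equiv> law_X Q \<Otimes>\<^sub>M uniform_count_measure (UNIV :: 'k set)"
  shows "measure N {z. ereal (score M (fst z) (uncertain_label f H u (fst z) (snd z))) \<le> t}
      + r_unc M f H u Q t - ramp_loss M Q
    \<le> measure Q {z. ereal (score M (fst z) (snd z)) \<le> t}"
proof -
  let ?B = "(borel :: (real^'d) measure) \<Otimes>\<^sub>M count_space (UNIV :: 'k set)"
  interpret Q: prob_space Q by fact
  have sQ: "sets Q = sets ?B" using Q(2) by (simp add: XY_space_def)
  note sQ[measurable_cong]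
  have sp[simp]: "space Q = UNIV"
    using sets_eq_imp_space_eq[OF sQ] by (simp add: space_pair_measure)
  have fstQ[measurable]: "fst \<in> measurable Q borel" by measurable
  interpret QX: prob_space "law_X Q" unfolding law_X_def by (rule Q.prob_space_distr) fact
  interpret nu: prob_space "uniform_count_measure (UNIV :: 'k set)"
    by (rule prob_space_uniform_count_measure) auto
  interpret N: pair_prob_space "law_X Q" "uniform_count_measure (UNIV :: 'k set)" by standard
  interpret NN: prob_space N unfolding N_def by (rule N.prob_space_axioms)
  have sN: "sets N = sets ?B"
    unfolding N_def law_X_def by (intro sets_pair_measure_cong) (auto simp: sets_uniform_count_measure)
  note sN[measurable_cong]
  have spN[simp]: "space N = UNIV"
    using sets_eq_imp_space_eq[OF sN] by (simp add: space_pair_measure)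
  note borel_measurable_score[OF M, measurable] borel_measurable_score_uncertain[OF M f(1) H, measurable]
    borel_measurable_score_classifier[OF M f(1), measurable] borel_measurable_margin[OF M, measurable]
    H[measurable]
  let ?F = "{z \<in> space N. ereal (score M (fst z) (uncertain_label f H u (fst z) (snd z))) \<le> t}"
  let ?R = "{z \<in> space N. H (fst z) > u \<and> ereal (score M (fst z) (f (fst z))) \<le> t
    \<and> t < ereal (score M (fst z) (snd z))}"
  let ?A = "{x \<in> space borel. ereal (score M x (f x)) \<le> t}"
  let ?G = "{z \<in> space Q. ereal (score M (fst z) (snd z)) \<le> t}"
  let ?m = "{z \<in> space Q. margin M (fst z) (snd z) \<le> 0}"
  have [measurable]: "?F \<in> sets N" "?R \<in> sets N" "?A \<in> sets borel" "?G \<in> sets Q" "?m \<in> sets Q"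
    by measurable
  \<comment> \<open>Disjoint: where \<open>H\<close> exceeds \<open>u\<close> the randomised label
    is \<open>v\<close> itself, and \<open>?R\<close> says that \<open>v\<close> is not
    covered.\<close>
  have "measure N ?F + measure N ?R = measure N (?F \<union> ?R)"
    by (rule NN.finite_measure_Union[symmetric]) (measurable, auto simp: uncertain_label_def)
  \<comment> \<open>The predicted label has the least score, so it is covered whenever the
    randomised one is. Conversely, if only the predicted label is covered, then \<open>H\<close>
    exceeds \<open>u\<close> and \<open>v\<close> is missed, which is \<open>?R\<close>.\<close>
  also have "?F \<union> ?R = fst -` ?A \<inter> space N"
    using score_classifier_le[OF f(2) K]
    by (auto simp: uncertain_label_def not_le split: if_splits intro: order_trans[rotated])
  \<comment> \<open>The event now depends on the feature alone, and \<open>N\<close> and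
    \<open>Q\<close> have the same feature marginal.\<close>
  also have "measure N (fst -` ?A \<inter> space N) = measure (distr N (law_X Q) fst) ?A"
    by (rule measure_distr[symmetric]) (auto simp: N_def law_X_def)
  also have "\<dots> = measure (law_X Q) ?A"
    unfolding N_def by (simp add: nu.distr_pair_fst)
  also have "\<dots> = measure Q (fst -` ?A \<inter> space Q)"
    unfolding law_X_def by (rule measure_distr) auto
  also have "\<dots> \<le> measure Q (?G \<union> ?m)"
  proof (rule Q.finite_measure_mono)
    \<comment> \<open>A positive margin at \<open>y\<close> forces \<open>y\<close> to be the
      predicted label.\<close>
    have "ereal (score M x y) \<le> t" if "ereal (score M x (f x)) \<le> t" "\<not> margin M x y \<le> 0" for x y
      using that margin_nonpos[OF f(2), of y x] by (cases "y = f x") auto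
    then show "fst -` ?A \<inter> space Q \<subseteq> ?G \<union> ?m" by auto
  qed measurable
  also have "\<dots> \<le> measure Q ?G + measure Q ?m"
    by (rule measure_Un_le) measurable
  also have "measure Q ?m \<le> ramp_loss M Q"
    using ramp_loss_ge[OF Q M] by simp
  finally show ?thesis
    unfolding r_unc_def N_def[symmetric] by (simp add: case_prod_unfold)
qed

section \<open>Averaging over the calibration data\<close>

theorem theorem2:
  fixes P Q :: "((real^'d) \<times> 'k::finite) measure"
    and M :: "real^'d \<Rightarrow> real^'k"
    and f :: "real^'d \<Rightarrow> 'k"
    and H :: "real^'d \<Rightarrow> real"
    and L \<rho> u \<alpha> :: real
    and n :: nat
  assumes K: "CARD('k) \<ge> 2"
    and P: "prob_space P" "sets P = sets XY_space"
    and Q: "prob_space Q" "sets Q = sets XY_space"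
    and M: "M \<in> borel_measurable borel"
    and f: "f \<in> measurable borel (count_space UNIV)" "classifier_of M f"
    and A1: "\<And>x x' y. \<bar>margin M x y - margin M x' y\<bar> \<le> L * norm (x - x')"
    and A2: "law_Y P = law_Y Q" "\<rho> > 0"
      "(SUP y\<in>{y. measure (law_Y P) {y} > 0}. W_inf (cond_law P y) (cond_law Q y)) < ereal \<rho>"
    and H: "H \<in> borel_measurable borel" "\<And>x. H x \<ge> 0"
    and \<alpha>: "0 < \<alpha>" "\<alpha> < 1"
    and n: "n \<ge> 1"
  shows
    "\<P>((xs, us, x, y) in joint_law n Q.
        y \<in> prediction_set M (threshold_uncertain M f H u \<alpha> n xs us) x)
     \<ge> \<P>((xs, us, x, y) in joint_law n Q.
        y \<in> prediction_set M (threshold_pseudo M f \<alpha> n xs) x)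
     \<and> \<P>((xs, us, x, y) in joint_law n Q.
        y \<in> prediction_set M (threshold_uncertain M f H u \<alpha> n xs us) x)
     \<ge> 1 - \<alpha> - ramp_loss M Q + R_unc M f H u \<alpha> n Q"
proof -
  define \<nu> where "\<nu> = uniform_count_measure (UNIV :: 'k set)"
  define N where "N = law_X Q \<Otimes>\<^sub>M \<nu>"
  define W where "W = calibration_X n Q \<Otimes>\<^sub>M (calibration_U n :: (nat \<Rightarrow> 'k) measure)"
  define g where "g = (\<lambda>z. score M (fst z) (uncertain_label f H u (fst z) (snd z)))"
  define D where "D = distr N borel g"
  define T where "T = (\<lambda>w. \<lambda>i\<in>{1..n}. g (fst w i, snd w i))"
  define q where "q = (\<lambda>w. threshold_uncertain M f H u \<alpha> n (fst w) (snd w))"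
  let ?B = "(borel :: (real^'d) measure) \<Otimes>\<^sub>M count_space (UNIV :: 'k set)"
  interpret Q: prob_space Q by fact
  have sQ: "sets Q = sets ?B" using Q(2) by (simp add: XY_space_def)
  note sQ[measurable_cong]
  have spQ[simp]: "space Q = UNIV"
    using sets_eq_imp_space_eq[OF sQ] by (simp add: space_pair_measure)
  have pQX: "prob_space (law_X Q)" unfolding law_X_def by (rule Q.prob_space_distr) measurable
  interpret QX: prob_space "law_X Q" by (rule pQX)
  have p\<nu>: "prob_space \<nu>" unfolding \<nu>_def by (rule prob_space_uniform_count_measure) auto
  interpret nu: prob_space \<nu> by (rule p\<nu>)
  interpret N: pair_prob_space "law_X Q" \<nu> by standard
  have pN: "prob_space N" unfolding N_def by (rule N.prob_space_axioms)
  have sN: "sets N = sets ?B"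
    unfolding N_def \<nu>_def law_X_def
    by (intro sets_pair_measure_cong) (auto simp: sets_uniform_count_measure)
  note sN[measurable_cong]
  have spN[simp]: "space N = UNIV"
    using sets_eq_imp_space_eq[OF sN] by (simp add: space_pair_measure)
  have pX: "prob_space (calibration_X n Q)"
    unfolding calibration_X_def by (rule prob_space_PiM) (rule pQX)
  have pU: "prob_space (calibration_U n :: (nat \<Rightarrow> 'k) measure)"
    unfolding calibration_U_def by (rule prob_space_PiM) (rule p\<nu>[unfolded \<nu>_def])
  interpret X: prob_space "calibration_X n Q" by (rule pX)
  interpret U: prob_space "calibration_U n :: (nat \<Rightarrow> 'k) measure" by (rule pU)
  interpret XU: pair_prob_space "calibration_X n Q" "calibration_U n :: (nat \<Rightarrow> 'k) measure" by standard
  have pW: "prob_space W" unfolding W_def by (rule XU.prob_space_axioms)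
  have g[measurable]: "g \<in> borel_measurable ?B"
    unfolding g_def by (rule borel_measurable_score_uncertain[OF M f(1) H(1)])
  note borel_measurable_score[OF M, measurable] H(1)[measurable]
    borel_measurable_score_classifier[OF M f(1), measurable]
  have gN: "g \<in> borel_measurable (law_X Q \<Otimes>\<^sub>M \<nu>)" using g sN by (simp add: N_def cong: measurable_cong_sets)
  \<comment> \<open>The randomised calibration scores are i.i.d. with law \<open>D\<close>, the law
    of the score of a fresh randomised pair.\<close>
  have dT: "distr W (\<Pi>\<^sub>M i\<in>{1..n}. D) T = (\<Pi>\<^sub>M i\<in>{1..n}. D)"
    using distr_PiM_pair[OF pQX p\<nu> _ gN, of "{1..n}"]
    by (simp add: W_def T_def D_def N_def calibration_X_def calibration_U_def \<nu>_def)
  have compg: "(\<lambda>w. g (fst w i, snd w i)) \<in> borel_measurable W" if i: "i \<in> {1..n}" for i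
  proof -
    have "(\<lambda>w. fst w i) \<in> measurable W (law_X Q)" "(\<lambda>w. snd w i) \<in> measurable W \<nu>"
      unfolding W_def calibration_X_def calibration_U_def \<nu>_def using i by measurable
    from measurable_compose[OF measurable_Pair[OF this] gN] show ?thesis .
  qed
  have T: "T \<in> measurable W (\<Pi>\<^sub>M i\<in>{1..n}. D)"
    unfolding T_def by (rule measurable_restrict) (use compg in \<open>simp add: D_def\<close>)
  have q_eq: "q w = conformal_threshold \<alpha> n (\<lambda>i. g (fst w i, snd w i))" for w
    by (simp add: q_def threshold_uncertain_def g_def)
  \<comment> \<open>\<open>T\<close> is undefined outside \<open>{1..n}\<close>, but the threshold
    reads only those indices; monotonicity in both directions expresses this.\<close>
  have q_T: "q w = conformal_threshold \<alpha> n (T w)" for w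
    unfolding q_eq by (intro antisym conformal_threshold_mono[OF n]) (auto simp: T_def)
  have qm[measurable]: "q \<in> borel_measurable W"
    unfolding q_eq using compg by (rule borel_measurable_conformal_threshold[OF n])

  \<comment> \<open>The three events have as slices the sets measured in \<open>?G\<close>,
    \<open>?F\<close> and \<open>?r\<close>; their measurability makes these functions of
    \<open>w\<close> integrable.\<close>
  define CG where "CG = {p \<in> space (W \<Otimes>\<^sub>M Q). ereal (score M (fst (snd p)) (snd (snd p))) \<le> q (fst p)}"
  define CF where "CF = {p \<in> space (W \<Otimes>\<^sub>M N). ereal (g (snd p)) \<le> q (fst p)}"
  define CR where "CR = {p \<in> space (W \<Otimes>\<^sub>M N). H (fst (snd p)) > u
    \<and> ereal (score M (fst (snd p)) (f (fst (snd p)))) \<le> q (fst p)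
    \<and> q (fst p) < ereal (score M (fst (snd p)) (snd (snd p)))}"
  have CG: "CG \<in> sets (W \<Otimes>\<^sub>M Q)" unfolding CG_def by measurable
  have CF: "CF \<in> sets (W \<Otimes>\<^sub>M N)" unfolding CF_def by measurable
  have CR: "CR \<in> sets (W \<Otimes>\<^sub>M N)" unfolding CR_def by measurable
  let ?G = "\<lambda>w. measure Q {z. ereal (score M (fst z) (snd z)) \<le> q w}"
  let ?F = "\<lambda>w. measure N {z. ereal (g z) \<le> q w}"
  let ?r = "\<lambda>w. r_unc M f H u Q (q w)"
  have iG: "integrable W ?G"
    by (rule Bochner_Integration.integrable_cong[THEN iffD1, OF refl _ integrable_measure_Pair[OF pW Q(1) CG]])
      (simp add: CG_def vimage_def space_pair_measure)
  have iF: "integrable W ?F"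
    by (rule Bochner_Integration.integrable_cong[THEN iffD1, OF refl _ integrable_measure_Pair[OF pW pN CF]])
      (simp add: CF_def vimage_def space_pair_measure)
  have iR: "integrable W ?r"
  proof (rule Bochner_Integration.integrable_cong[THEN iffD1, OF refl _ integrable_measure_Pair[OF pW pN CR]])
    fix w assume "w \<in> space W"
    then have "Pair w -` CR = {(x, v). H x > u \<and> ereal (score M x (f x)) \<le> q w \<and> q w < ereal (score M x v)}"
      by (auto simp: CR_def space_pair_measure)
    then show "measure N (Pair w -` CR) = ?r w"
      by (simp add: r_unc_def N_def \<nu>_def)
  qed

  have pD: "prob_space D" unfolding D_def N_def by (rule N.prob_space_distr[OF gN])
  have sD: "sets D = sets borel" by (simp add: D_def)
  \<comment> \<open>Conformal coverage for scores of law \<open>D\<close>, transported along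
    \<open>T\<close> to the calibration data and along \<open>g\<close> to a fresh feature and
    random label.\<close>
  have F: "1 - \<alpha> \<le> (\<integral>w. ?F w \<partial>W)"
  proof -
    let ?PD = "\<Pi>\<^sub>M i\<in>{1..n}. D"
    let ?h = "\<lambda>S. measure D {s. ereal s \<le> conformal_threshold \<alpha> n S}"
    have pPD: "prob_space ?PD" by (rule prob_space_PiM) (rule pD)
    have "(\<lambda>S. S i) \<in> borel_measurable ?PD" if "i \<in> {1..n}" for i
      using measurable_component_singleton[OF that, of "\<lambda>_. D"]
      by (simp add: measurable_cong_sets[OF refl sD])
    then have [measurable]: "conformal_threshold \<alpha> n \<in> borel_measurable ?PD"
      by (rule borel_measurable_conformal_threshold[OF n])
    note sD[measurable_cong]
    have spD: "space D = UNIV" using sets_eq_imp_space_eq[OF sD] by simp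
    have CD: "{p \<in> space (?PD \<Otimes>\<^sub>M D). ereal (snd p) \<le> conformal_threshold \<alpha> n (fst p)} \<in> sets (?PD \<Otimes>\<^sub>M D)"
      by measurable
    have "integrable ?PD ?h"
      by (rule Bochner_Integration.integrable_cong[THEN iffD1, OF refl _ integrable_measure_Pair[OF pPD pD CD]])
        (simp add: vimage_def space_pair_measure spD)
    then have h: "?h \<in> borel_measurable ?PD" by simp
    have "1 - \<alpha> \<le> (\<integral>S. ?h S \<partial>?PD)"
      by (rule conformal_coverage[OF pD sD n \<alpha>(1)])
    also have "\<dots> = (\<integral>S. ?h S \<partial>distr W ?PD T)" by (simp only: dT)
    also have "\<dots> = (\<integral>w. ?h (T w) \<partial>W)" by (rule integral_distr[OF T h])
    also have "\<dots> = (\<integral>w. ?F w \<partial>W)"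
    proof (intro Bochner_Integration.integral_cong refl)
      fix w
      have "{s \<in> space borel. ereal s \<le> q w} \<in> sets borel" by measurable
      then have "measure D {s. ereal s \<le> q w} = measure N (g -` {s. ereal s \<le> q w} \<inter> space N)"
        unfolding D_def by (intro measure_distr) auto
      then show "?h (T w) = ?F w" by (simp add: q_T vimage_def)
    qed
    finally show ?thesis .
  qed

  define S where "S = {p \<in> space (joint_law n Q). ereal (score M (fst (snd (snd p))) (snd (snd (snd p)))) \<le> q (fst p, fst (snd p))}"
  have S_eq: "measure (joint_law n Q) S = \<P>((xs, us, x, y) in joint_law n Q.
      y \<in> prediction_set M (threshold_uncertain M f H u \<alpha> n xs us) x)"
    by (rule arg_cong[where f="measure (joint_law n Q)"]) (auto simp: S_def q_def prediction_set_def)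
  have S: "S \<in> sets (calibration_X n Q \<Otimes>\<^sub>M ((calibration_U n :: (nat \<Rightarrow> 'k) measure) \<Otimes>\<^sub>M Q))"
  proof -
    have [measurable]: "(\<lambda>p. q (fst p, fst (snd p))) \<in>
        borel_measurable (calibration_X n Q \<Otimes>\<^sub>M ((calibration_U n :: (nat \<Rightarrow> 'k) measure) \<Otimes>\<^sub>M Q))"
      by (rule measurable_compose[OF _ qm]) (simp add: W_def)
    show ?thesis unfolding S_def joint_law_def by measurable
  qed
  \<comment> \<open>The test pair is independent of the calibration data, so coverage is the average
    over \<open>w\<close> of the coverage at the fixed threshold \<open>q w\<close>.\<close>
  have "measure (joint_law n Q) S = (\<integral>w. measure Q {z. (fst w, snd w, z) \<in> S} \<partial>W)"
    unfolding joint_law_def W_def by (rule measure_triple_eq_integral[OF pX pU Q(1) S])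
  also have "\<dots> = (\<integral>w. ?G w \<partial>W)"
    by (intro Bochner_Integration.integral_cong refl)
      (auto simp: S_def W_def joint_law_def space_pair_measure)
  finally have cov: "measure (joint_law n Q) S = (\<integral>w. ?G w \<partial>W)" .

  interpret W: prob_space W by (rule pW)
  have R: "R_unc M f H u \<alpha> n Q = (\<integral>w. ?r w \<partial>W)"
    by (simp add: R_unc_def W_def q_def case_prod_unfold)
  \<comment> \<open>The fixed-threshold inequality holds for every extended real \<open>t\<close>,
    hence at \<open>q w\<close> for each \<open>w\<close>, even when it is infinite.\<close>
  have "(\<integral>w. ?F w + ?r w - ramp_loss M Q \<partial>W) \<le> (\<integral>w. ?G w \<partial>W)"
    using iF iR iG coverage_at_threshold_ge[OF K Q M f H(1), of u]
    by (intro integral_mono) (auto simp: N_def \<nu>_def g_def)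
  also have "(\<integral>w. ?F w + ?r w - ramp_loss M Q \<partial>W) = (\<integral>w. ?F w \<partial>W) + (\<integral>w. ?r w \<partial>W) - ramp_loss M Q"
    using iF iR by (simp add: W.prob_space)
  finally have ii: "1 - \<alpha> - ramp_loss M Q + R_unc M f H u \<alpha> n Q \<le> measure (joint_law n Q) S"
    using F unfolding cov R by linarith

  \<comment> \<open>The thresholds are ordered for every sample, so coverage with the pseudo-label
    threshold implies the event \<open>S\<close>; this gives (i) by monotonicity.\<close>
  have thr: "threshold_pseudo M f \<alpha> n xs \<le> threshold_uncertain M f H u \<alpha> n xs us" for xs us
    unfolding threshold_pseudo_def threshold_uncertain_def
    by (intro conformal_threshold_mono[OF n] score_classifier_le[OF f(2) K])
  interpret UQ: pair_prob_space "calibration_U n :: (nat \<Rightarrow> 'k) measure" Q by standard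
  interpret J: pair_prob_space "calibration_X n Q" "(calibration_U n :: (nat \<Rightarrow> 'k) measure) \<Otimes>\<^sub>M Q" by standard
  have i: "\<P>((xs, us, x, y) in joint_law n Q. y \<in> prediction_set M (threshold_pseudo M f \<alpha> n xs) x)
      \<le> measure (joint_law n Q) S"
    unfolding joint_law_def
    by (rule J.finite_measure_mono[OF _ S])
      (use order_trans[OF _ thr] in \<open>auto simp: S_def q_def joint_law_def prediction_set_def\<close>)
  show ?thesis
    using i ii unfolding S_eq by blast
qed

end
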